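(* Let $L=\lambda_6$ be the three dimensional nilpotent Leibniz algebra over $\mathbb{C}$ with basis $e_1,e_2,e_3$ and bracket $[e_1,e_3]=e_2$, $[e_3,e_3]=e_1$, all other brackets of basis elements being $0$. Let $[\,,]_{t,s}$ be the $\mathbb{C}[[t,s]]$-bilinear operation on $\mathbb{C}[[t,s]]\otimes L$ given by $$[e_1,e_3]_{t,s}=e_2+s\,e_1,\qquad [e_3,e_3]_{t,s}=e_1,\qquad [e_2,e_3]_{t,s}=-t\,e_1,$$ with all other brackets of basis elements being $0$ (here $e_i$ stands for $1\otimes e_i$). Then $[\,,]_{t,s}$ is a formal deformation of $L$ with base $\mathbb{C}[[t,s]]$, and it is a versal deformation of $L$.
   Context: A Leibniz algebra over a commutative ring $R$ is an $R$-module with an $R$-bilinear bracket satisfying $[x,[y,z]]=[[x,y],z]-[[x,z],y]$. Let $\mathbb{K}$ be a field of characteristic zero (here $\mathbb{K}=\mathbb{C}$), $\otimes=\otimes_{\mathbb{K}}$. A base is a commutative unital local $\mathbb{K}$-algebra $A$ with a fixed augmentation $\varepsilon:A\to\mathbb{K}$ whose kernel is the maximal ideal $\mathfrak{M}$, with $\dim(\mathfrak{M}^k/\mathfrak{M}^{k+1})<\infty$ for all $k$. A deformation of a Leibniz algebra $L$ with base $A$ is an $A$-Leibniz algebra structure $[\,,]_\lambda$ on $A\otimes L$ such that $\varepsilon\otimes \mathrm{id}:A\otimes L\to\mathbb{K}\otimes L=L$ is a homomorphism of Leibniz algebras. If $A$ is complete, i.e. $A=\varprojlim_n A/\mathfrak{M}^n$,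 a formal deformation of $L$ with base $A$ is a projective limit of deformations of $L$ with bases $A/\mathfrak{M}^n$ (for finite dimensional $L$ it is a structure on $A\otimes L$). Two deformations $\lambda_1,\lambda_2$ with the same base $A$ are equivalent if there is an isomorphism of $A$-Leibniz algebras $\phi:(A\otimes L,[\,,]_{\lambda_1})\to(A\otimes L,[\,,]_{\lambda_2})$ with $(\varepsilon\otimes\mathrm{id})\circ\phi=\varepsilon\otimes\mathrm{id}$. If $f:A\to A'$ is a unital algebra homomorphism between bases with $\varepsilon'\circ f=\varepsilon$, and $[1\otimes l_1,1\otimes l_2]_\lambda=1\otimes[l_1,l_2]+\sum_j c_j\otimes y_j$ with $c_j\in\mathfrak{M}$, $y_j\in L$, then the push-out $f_*\lambda$ is the deformation with base $A'$ given by $[1\otimes l_1,1\otimes l_2]_{f_*\lambda}=1\otimes[l_1,l_2]+\sum_j f(c_j)\otimes y_j$. For complete bases the push-out is defined by passing to projective limits. A formal deformation $\eta$ of $L$ with complete local base $C$ is called versal if: (i) for every formal deformation $\lambda$ of $L$ with (complete local) base $A$ there exists a homomorphism $f:C\to A$ (unital, compatible with augmentations) such that $\lambda$ is equivalent to $f_*\eta$; (ii) if the maximal ideal $\mathfrak{M}$ of $A$ satisfies $\mathfrak{M}^2=0$, then this $f$ is unique. The augmentation of $\mathbb{C}[[t,s]]$ is evaluation at $t=s=0$. *)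

theory Defs
  imports
    "HOL-Analysis.Finite_Cartesian_Product"
    "HOL-Analysis.Cartesian_Space"
    "HOL-Computational_Algebra.Formal_Power_Series"
begin

section \<open>Leibniz algebras over a commutative ring\<close>

locale leibniz_algebra = module smul
  for smul :: "'r::comm_ring_1 \<Rightarrow> 'm::ab_group_add \<Rightarrow> 'm" +
  fixes bracket :: "'m \<Rightarrow> 'm \<Rightarrow> 'm"
  assumes linear_left: "\<And>y. module_hom smul smul (\<lambda>x. bracket x y)"
    and linear_right: "\<And>x. module_hom smul smul (\<lambda>y. bracket x y)"
    and leibniz: "\<And>x y z.
      bracket x (bracket y z) = bracket (bracket x y) z - bracket (bracket x z) y"


section \<open>Bases\<close>

text \<open>Ideals of a ring are its submodules as a module over itself.\<close>

definition maximal_ideal :: "'a::comm_ring_1 set \<Rightarrow> bool" where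
  "maximal_ideal I \<longleftrightarrow> module.subspace (*) I \<and> I \<noteq> UNIV \<and>
     (\<forall>J. module.subspace (*) J \<and> I \<subseteq> J \<longrightarrow> J = I \<or> J = UNIV)"

primrec ideal_power :: "'a::comm_ring_1 set \<Rightarrow> nat \<Rightarrow> 'a set" where
  "ideal_power I 0 = UNIV"
| "ideal_power I (Suc n) = module.span (*) {x * y | x y. x \<in> I \<and> y \<in> ideal_power I n}"

locale base = vector_space smul
  for smul :: "'k::field_char_0 \<Rightarrow> 'a::comm_ring_1 \<Rightarrow> 'a" +
  fixes aug :: "'a \<Rightarrow> 'k"
  assumes smul_mult: "\<And>c x y. smul c (x * y) = smul c x * y"
    and aug_linear: "Vector_Spaces.linear smul (*) aug"
    and aug_mult: "\<And>x y. aug (x * y) = aug x * aug y"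
    and aug_one: "aug 1 = 1"
    and local: "\<And>I. maximal_ideal I \<longleftrightarrow> I = {x. aug x = 0}"
    \<comment> \<open>the quotient of consecutive powers of the maximal ideal is spanned by the
      classes of finitely many elements\<close>
    and finite_dim: "\<And>k. \<exists>B. finite B \<and> B \<subseteq> ideal_power {x. aug x = 0} k \<and>
      (\<forall>x \<in> ideal_power {x. aug x = 0} k. \<exists>b \<in> module.span smul B.
         x - b \<in> ideal_power {x. aug x = 0} (Suc k))"

text \<open>
  Completeness with respect to the maximal ideal \<open>M\<close>: the canonical map to
  the projective limit of the quotients \<open>A/M\<^sup>n\<close> is bijective. Elements of
  \<open>A/M\<^sup>n\<close> are cosets, and the transition map sends a coset of
  \<open>M\<^sup>n\<^sup>+\<^sup>1\<close> to the unique coset of \<open>M\<^sup>n\<close> containing it.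
\<close>

locale complete_base = base +
  assumes complete:
    "bij_betw (\<lambda>a n. (+) a ` ideal_power {x. aug x = 0} n) UNIV
       {X. (\<forall>n. \<exists>a. X n = (+) a ` ideal_power {x. aug x = 0} n) \<and>
           (\<forall>n. X (Suc n) \<subseteq> X n)}"

locale base_hom = source: base smul aug + target: base smul' aug' +
  module_hom smul smul' f
  for smul :: "'k::field_char_0 \<Rightarrow> 'a::comm_ring_1 \<Rightarrow> 'a" and aug :: "'a \<Rightarrow> 'k"
    and smul' :: "'k \<Rightarrow> 'b::comm_ring_1 \<Rightarrow> 'b" and aug' :: "'b \<Rightarrow> 'k"
    and f :: "'a \<Rightarrow> 'b" +
  assumes mult: "\<And>x y. f (x * y) = f x * f y"
    and one: "f 1 = 1"
    and aug_compat: "\<And>x. aug' (f x) = aug x"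


section \<open>Deformations\<close>

text \<open>
  A finite dimensional Leibniz algebra \<open>L\<close> is given by a bracket on the coordinate
  space \<open>'k ^ 'n\<close>. The \<open>A\<close>-module \<open>A \<otimes> L\<close> is then the free
  module \<open>'a ^ 'n\<close>, with the pure tensors below, and the elements
  \<open>1 \<otimes> e\<^sub>i\<close> are the \<open>axis i 1\<close>.
\<close>

definition pure_tensor :: "('k \<Rightarrow> 'a \<Rightarrow> 'a) \<Rightarrow> 'a \<Rightarrow> 'k ^ 'n \<Rightarrow> 'a ^ 'n" where
  "pure_tensor smul a l = (\<chi> i. smul (l $ i) a)"

text \<open>
  For linear \<open>f\<close>, this is the map \<open>f \<otimes> id\<close>. With
  \<open>f = aug\<close> it is the map from \<open>A \<otimes> L\<close> to \<open>L\<close>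
  induced by the augmentation.
\<close>

definition map_coeffs :: "('a \<Rightarrow> 'b) \<Rightarrow> 'a ^ 'n \<Rightarrow> 'b ^ 'n" where
  "map_coeffs f v = (\<chi> i. f (v $ i))"

text \<open>The bilinear operation with prescribed values on pairs of basis elements.\<close>

definition bilinear_extension ::
    "('n \<Rightarrow> 'n \<Rightarrow> 'a ^ 'n) \<Rightarrow> 'a ^ 'n \<Rightarrow> 'a ^ 'n \<Rightarrow> ('a::comm_ring_1) ^ 'n" where
  "bilinear_extension c v w = (\<Sum>i\<in>UNIV. \<Sum>j\<in>UNIV. (v $ i * w $ j) *s c i j)"

locale deformation =
  base smul aug +
  fiber: leibniz_algebra "(*s)" L +
  total: leibniz_algebra "(*s)" D
  for smul :: "'k::field_char_0 \<Rightarrow> 'a::comm_ring_1 \<Rightarrow> 'a" and aug :: "'a \<Rightarrow> 'k"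
    and L :: "'k ^ 'n \<Rightarrow> 'k ^ 'n \<Rightarrow> 'k ^ 'n"
    and D :: "'a ^ 'n \<Rightarrow> 'a ^ 'n \<Rightarrow> 'a ^ 'n" +
  assumes aug_bracket:
    "\<And>v w. map_coeffs aug (D v w) = L (map_coeffs aug v) (map_coeffs aug w)"

text \<open>
  As \<open>L\<close> is finite dimensional and the base complete, a projective limit of
  deformations with bases \<open>A/M\<^sup>n\<close> is a structure on \<open>A \<otimes> L\<close>.
\<close>

locale formal_deformation = deformation + complete_base

definition equivalent_deformations ::
    "('a::comm_ring_1 \<Rightarrow> 'k) \<Rightarrow> ('a ^ 'n \<Rightarrow> 'a ^ 'n \<Rightarrow> 'a ^ 'n) \<Rightarrow>
     ('a ^ 'n \<Rightarrow> 'a ^ 'n \<Rightarrow> 'a ^ 'n) \<Rightarrow> bool" where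
  "equivalent_deformations aug D1 D2 \<longleftrightarrow>
     (\<exists>\<phi>. module_hom (*s) (*s) \<phi> \<and> bij \<phi> \<and>
          (\<forall>v w. \<phi> (D1 v w) = D2 (\<phi> v) (\<phi> w)) \<and>
          (\<forall>v. map_coeffs aug (\<phi> v) = map_coeffs aug v))"

text \<open>
  The push-out \<open>f\<^sub>* D\<close>; the lemma \<open>push_out_pure_tensor\<close>
  below is its defining formula on elements \<open>1 \<otimes> l\<close>.
\<close>

definition push_out ::
    "('a::comm_ring_1 \<Rightarrow> 'b::comm_ring_1) \<Rightarrow> ('a ^ 'n \<Rightarrow> 'a ^ 'n \<Rightarrow> 'a ^ 'n) \<Rightarrow>
     'b ^ 'n \<Rightarrow> 'b ^ 'n \<Rightarrow> 'b ^ 'n" where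
  "push_out f D = bilinear_extension (\<lambda>i j. map_coeffs f (D (axis i 1) (axis j 1)))"

lemma map_coeffs_pure_tensor:
  assumes "module_hom smul smul' f"
  shows "map_coeffs f (pure_tensor smul a l) = pure_tensor smul' (f a) l"
  using module_hom.scale[OF assms] by (simp add: map_coeffs_def pure_tensor_def)

lemma push_out_pure_tensor:
  fixes L :: "'k::field_char_0 ^ 'n \<Rightarrow> 'k ^ 'n \<Rightarrow> 'k ^ 'n"
  assumes D: "deformation smul aug L D" and f: "base_hom smul aug smul' aug' f"
    and eq: "D (pure_tensor smul 1 l1) (pure_tensor smul 1 l2) =
      pure_tensor smul 1 (L l1 l2) + (\<Sum>j\<in>J. pure_tensor smul (c j) (y j))"
  shows "push_out f D (pure_tensor smul' 1 l1) (pure_tensor smul' 1 l2) =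
    pure_tensor smul' 1 (L l1 l2) + (\<Sum>j\<in>J. pure_tensor smul' (f (c j)) (y j))"
proof -
  interpret D: deformation smul aug L D by (rule D)
  interpret f: base_hom smul aug smul' aug' f by (rule f)
  have pt: "pure_tensor smul 1 l = (\<Sum>i\<in>UNIV. smul (l $ i) 1 *s axis i 1)" for l :: "'k ^ 'n"
    using basis_expansion[of "pure_tensor smul 1 l"] by (simp add: pure_tensor_def)
  have "D (pure_tensor smul 1 l1) (pure_tensor smul 1 l2) =
      (\<Sum>i\<in>UNIV. \<Sum>j\<in>UNIV. (smul (l1 $ i) 1 * smul (l2 $ j) 1) *s D (axis i 1) (axis j 1))"
    unfolding pt module_hom.sum[OF D.total.linear_left] module_hom.sum[OF D.total.linear_right]
      module_hom.scale[OF D.total.linear_left] module_hom.scale[OF D.total.linear_right]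
    by (subst sum.swap) (simp add: D.total.scale_sum_right vector_smult_assoc mult.commute)
  moreover have "f (smul a 1) = smul' a 1" for a
    by (simp add: f.scale f.one)
  ultimately have "push_out f D (pure_tensor smul' 1 l1) (pure_tensor smul' 1 l2) =
      map_coeffs f (D (pure_tensor smul 1 l1) (pure_tensor smul 1 l2))"
    by (simp add: push_out_def bilinear_extension_def map_coeffs_def pure_tensor_def
        vec_eq_iff f.sum f.mult)
  also have "\<dots> = map_coeffs f (pure_tensor smul 1 (L l1 l2)) +
      (\<Sum>j\<in>J. map_coeffs f (pure_tensor smul (c j) (y j)))"
    unfolding eq by (simp add: map_coeffs_def vec_eq_iff f.add f.sum)
  finally show ?thesis
    by (simp add: map_coeffs_pure_tensor[OF f.module_hom_axioms] f.one)
qed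

text \<open>
  Versality of a formal deformation \<open>\<eta>\<close> with base \<open>C\<close>, tested against
  all formal deformations whose base has carrier type \<open>'a\<close>. HOL cannot quantify
  over \<open>'a\<close> inside a formula; versality itself is this property for a free type
  variable \<open>'a\<close>, that is, for all types.
\<close>

definition versal ::
    "'a::comm_ring_1 itself \<Rightarrow> ('k::field_char_0 \<Rightarrow> 'c::comm_ring_1 \<Rightarrow> 'c) \<Rightarrow> ('c \<Rightarrow> 'k) \<Rightarrow>
     ('k ^ 'n \<Rightarrow> 'k ^ 'n \<Rightarrow> 'k ^ 'n) \<Rightarrow> ('c ^ 'n \<Rightarrow> 'c ^ 'n \<Rightarrow> 'c ^ 'n) \<Rightarrow> bool" where
  "versal (_ :: 'a itself) smulC augC L \<eta> \<longleftrightarrow>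
     formal_deformation smulC augC L \<eta> \<and>
     (\<forall>(smul :: 'k \<Rightarrow> 'a \<Rightarrow> 'a) aug D. formal_deformation smul aug L D \<longrightarrow>
        (\<exists>f. base_hom smulC augC smul aug f \<and>
             equivalent_deformations aug D (push_out f \<eta>)) \<and>
        (ideal_power {x. aug x = 0} 2 = {0} \<longrightarrow>
           (\<exists>!f. base_hom smulC augC smul aug f \<and>
                 equivalent_deformations aug D (push_out f \<eta>))))"


section \<open>The algebra and its deformation\<close>

definition lambda6 :: "complex ^ 3 \<Rightarrow> complex ^ 3 \<Rightarrow> complex ^ 3" where
  "lambda6 = bilinear_extension (\<lambda>i j.
     if i = 1 \<and> j = 3 then axis 2 1
     else if i = 3 \<and> j = 3 then axis 1 1
     else 0)"

text \<open>The power series ring in \<open>t\<close> and \<open>s\<close> is the ring of power series in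
  \<open>s\<close> over the power series in \<open>t\<close>.\<close>

type_synonym power_series_ts = "complex fps fps"

abbreviation var_t :: power_series_ts where
  "var_t \<equiv> fps_const fps_X"

abbreviation var_s :: power_series_ts where
  "var_s \<equiv> fps_X"

definition smul_ts :: "complex \<Rightarrow> power_series_ts \<Rightarrow> power_series_ts" where
  "smul_ts c p = fps_const (fps_const c) * p"

definition aug_ts :: "power_series_ts \<Rightarrow> complex" where
  "aug_ts p = fps_nth (fps_nth p 0) 0"

definition lambda6_ts ::
    "power_series_ts ^ 3 \<Rightarrow> power_series_ts ^ 3 \<Rightarrow> power_series_ts ^ 3" where
  "lambda6_ts = bilinear_extension (\<lambda>i j.
     if i = 1 \<and> j = 3 then axis 2 1 + var_s *s axis 1 1
     else if i = 3 \<and> j = 3 then axis 1 1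
     else if i = 2 \<and> j = 3 then (- var_t) *s axis 1 1
     else 0)"

end

theory Submission
  imports Defs
begin

text \<open>
  Let \<open>D\<close> be a deformation of \<open>L\<close> with base \<open>A\<close>, let \<open>R = [-, e3]\<close>, and put
  \<open>f1 = R e3\<close>, \<open>f2 = R f1\<close>. Modulo the maximal ideal, \<open>f1, f2, e3\<close> is the basis
  \<open>e1, e2, e3\<close>, so it is a basis of \<open>A \<otimes> L\<close>. By the Leibniz identity
  \<open>f1\<close>, \<open>f2\<close> and \<open>R f2\<close> act by zero from the right. So the \<open>e3\<close>-coefficient
  of \<open>R f2\<close> vanishes, \<open>R f2 = a f2 + b f1\<close> with \<open>a\<close> and \<open>b\<close> in the maximal ideal,
  and these two elements determine \<open>D\<close>. For the operation \<open>[,]\<close> of the theorem they are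
  \<open>s\<close> and \<open>-t\<close>, so \<open>D\<close> is equivalent to its push-out under any
  homomorphism with \<open>s \<mapsto> a\<close>, \<open>t \<mapsto> -b\<close>, and there is one as \<open>A\<close> is complete.
  If the maximal ideal has square zero, then \<open>R\<^sup>3 e3 = a R\<^sup>2 e3 + b R e3\<close> is invariant under
  equivalence, so \<open>a\<close> and \<open>b\<close>, and hence the homomorphism, are unique.
\<close>

section \<open>Complete bases\<close>

text \<open>Interpreting the locale instead would make
  \<open>a * (b * x) = a * b * x\<close> a simplification rule.\<close>

lemma ring_module: "module ((*) :: 'a::comm_ring_1 \<Rightarrow> 'a \<Rightarrow> 'a)"
  by unfold_locales (simp_all add: algebra_simps)

lemmas ideal_0 = module.subspace_0[OF ring_module]
  and ideal_add = module.subspace_add[OF ring_module]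
  and ideal_neg = module.subspace_neg[OF ring_module]
  and ideal_diff = module.subspace_diff[OF ring_module]
  and ideal_scale = module.subspace_scale[OF ring_module]
  and idealI = module.subspaceI[OF ring_module]
  and ideal_UNIV = module.subspace_UNIV[OF ring_module]
  and ideal_span = module.subspace_span[OF ring_module]
  and ideal_span_base = module.span_base[OF ring_module]
  and ideal_span_minimal = module.span_minimal[OF ring_module]

lemma subspace_ideal_power: "module.subspace (*) (ideal_power I n)"
  by (cases n) (simp_all add: ideal_UNIV ideal_span)

lemma ideal_power_mult:
  assumes "x \<in> I" "y \<in> ideal_power I n"
  shows "x * y \<in> ideal_power I (Suc n)"
  using assms by (auto intro: ideal_span_base)

lemma power_in_ideal_power: "x \<in> I \<Longrightarrow> x ^ n \<in> ideal_power I n"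
  by (induction n) (simp, simp only: power_Suc ideal_power_mult)

lemma ideal_power_Suc_subset: "ideal_power I (Suc n) \<subseteq> ideal_power I n"
  unfolding ideal_power.simps
  by (rule ideal_span_minimal)
    (auto intro: ideal_scale[OF subspace_ideal_power] subspace_ideal_power)

lemma translate_subgroup_eq_iff:
  fixes a b :: "'a::comm_ring_1"
  assumes "module.subspace (*) S"
  shows "(+) a ` S = (+) b ` S \<longleftrightarrow> a - b \<in> S"
proof
  assume "(+) a ` S = (+) b ` S"
  moreover have "a + 0 \<in> (+) a ` S"
    using ideal_0[OF assms] by blast
  ultimately show "a - b \<in> S" by auto
next
  have sub: "(+) x ` S \<subseteq> (+) y ` S" if "x - y \<in> S" for x y
  proof
    fix z assume "z \<in> (+) x ` S"
    then obtain w where "w \<in> S" "z = y + (x - y + w)" by auto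
    then show "z \<in> (+) y ` S"
      using ideal_add[OF assms that] by blast
  qed
  assume *: "a - b \<in> S"
  then have "b - a \<in> S"
    using ideal_neg[OF assms *] by simp
  with * sub show "(+) a ` S = (+) b ` S" by blast
qed

section \<open>The augmentation ideal and completeness in terms of elements\<close>

context base
begin

abbreviation M :: "'a set" where "M \<equiv> {x. aug x = 0}"

lemma aug_zero: "aug 0 = 0"
  and aug_add: "aug (x + y) = aug x + aug y"
  and aug_minus: "aug (- x) = - aug x"
  and aug_diff: "aug (x - y) = aug x - aug y"
  and aug_smul: "aug (smul c x) = c * aug x"
proof -
  interpret aug: Vector_Spaces.linear smul "(*)" aug by (rule aug_linear)
  show "aug 0 = 0" "aug (x + y) = aug x + aug y" "aug (- x) = - aug x"
    "aug (x - y) = aug x - aug y" "aug (smul c x) = c * aug x"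
    by (simp_all add: aug.zero aug.add aug.neg aug.diff aug.scale)
qed

lemma subspace_M: "module.subspace (*) M"
  by (rule idealI) (simp_all add: aug_zero aug_add aug_mult)

lemma ideal_power_1: "ideal_power M (Suc 0) \<subseteq> M"
  unfolding ideal_power.simps by (rule ideal_span_minimal[OF _ subspace_M]) (auto simp: aug_mult)

end

context complete_base
begin

lemma ideal_power_separated:
  assumes "\<And>n. a - b \<in> ideal_power M n"
  shows "a = b"
  using bij_betw_imp_inj_on[OF complete] assms
  by (simp add: inj_def fun_eq_iff translate_subgroup_eq_iff[OF subspace_ideal_power])

text \<open>Consecutive differences in M^n make the cosets of \<open>T n\<close> a coherent
  sequence, and surjectivity of the canonical map onto the projective limit provides the
  limit.\<close>

lemma ideal_power_complete:
  assumes "\<And>n. T (Suc n) - T n \<in> ideal_power M n"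
  obtains a where "\<And>n. a - T n \<in> ideal_power M n"
proof -
  have "(+) (T (Suc n)) ` ideal_power M (Suc n) \<subseteq> (+) (T n) ` ideal_power M n" for n
    using translate_subgroup_eq_iff[OF subspace_ideal_power, of "T (Suc n)" M n "T n"] assms[of n]
      ideal_power_Suc_subset[of M n] by blast
  then have "(\<lambda>n. (+) (T n) ` ideal_power M n) \<in>
      {X. (\<forall>n. \<exists>a. X n = (+) a ` ideal_power M n) \<and> (\<forall>n. X (Suc n) \<subseteq> X n)}"
    by blast
  then obtain a where "(\<lambda>n. (+) (T n) ` ideal_power M n) = (\<lambda>n. (+) a ` ideal_power M n)"
    using bij_betw_imp_surj_on[OF complete] by (metis (no_types, lifting) image_iff)
  then show thesis
    using that by (metis translate_subgroup_eq_iff[OF subspace_ideal_power])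
qed

end

subsection \<open>Evaluation of power series\<close>

text \<open>Cut off after \<open>n\<close> terms because the remaining terms carry a factor
  \<open>b ^ n\<close>, which lies in M^n when \<open>b\<close> is in the maximal ideal.\<close>

definition partial_eval :: "('r \<Rightarrow> 'a) \<Rightarrow> 'a \<Rightarrow> nat \<Rightarrow> 'r fps \<Rightarrow> 'a::comm_ring_1" where
  "partial_eval g b n p = (\<Sum>i<n. g (fps_nth p i) * b ^ i)"

lemma partial_eval_Suc:
  "partial_eval g b (Suc n) p = g (fps_nth p 0) + b * partial_eval g b n (fps_shift 1 p)"
proof -
  have "g (fps_nth p (Suc i)) * b ^ Suc i = b * (g (fps_nth p (Suc i)) * b ^ i)" for i
    by (simp add: mult.left_commute)
  then show ?thesis
    by (simp only: partial_eval_def sum.lessThan_Suc_shift sum_distrib_left) simp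
qed

lemma partial_eval_add:
  assumes "\<And>x y. g (x + y) = g x + g y"
  shows "partial_eval g b n (p + q) = partial_eval g b n p + partial_eval g b n q"
  by (simp add: partial_eval_def assms sum.distrib algebra_simps)

lemma partial_eval_const_mult:
  fixes g :: "'r::comm_ring_1 \<Rightarrow> 'a::comm_ring_1"
  assumes "\<And>x y. g (x * y) = g x * g y"
  shows "partial_eval g b n (fps_const c * p) = g c * partial_eval g b n p"
  by (simp add: partial_eval_def assms sum_distrib_left mult.assoc)

text \<open>Write p = p0 + X p' and q = q0 + X q'. Then p q = p0 q0 + X (p0 q' + p' q).\<close>

lemma fps_shift_1_mult:
  fixes p q :: "'r::comm_ring_1 fps"
  shows "fps_shift 1 (p * q) = fps_const (fps_nth p 0) * fps_shift 1 q + fps_shift 1 p * q"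
  by (rule fps_ext) (simp add: fps_mult_nth sum.atLeast_Suc_atMost sum.shift_bounds_cl_Suc_ivl
      del: sum.cl_ivl_Suc)

text \<open>Both sides agree up to terms with at least \<open>n\<close> factors \<open>b\<close>.
  The induction peels off the constant term of \<open>p\<close>, which leaves a factor
  \<open>b\<close> in front of the same statement for \<open>fps_shift 1 p\<close>.\<close>

lemma partial_eval_mult:
  fixes g :: "'r::comm_ring_1 \<Rightarrow> 'a::comm_ring_1"
  assumes add: "\<And>x y. g (x + y) = g x + g y" and mult: "\<And>x y. g (x * y) = g x * g y"
  shows "b ^ n dvd partial_eval g b n (p * q) - partial_eval g b n p * partial_eval g b n q"
proof (induction n arbitrary: p q)
  case 0
  then show ?case by simp
next
  case (Suc n)
  let ?T = "partial_eval g b n" and ?s = "fps_shift 1"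
  have q: "partial_eval g b (Suc n) q = ?T q + g (fps_nth q n) * b ^ n"
    by (simp add: partial_eval_def)
  \<comment> \<open>One truncation of \<open>q\<close> is split off at its lowest and at its highest
    term: the product rule for shifts yields the first form, the induction hypothesis needs the
    second.\<close>
  have "g (fps_nth q 0) + b * ?T (?s q) = ?T q + g (fps_nth q n) * b ^ n"
    using q by (simp only: partial_eval_Suc)
  then have "g (fps_nth p 0) * (g (fps_nth q 0) + b * ?T (?s q)) =
      g (fps_nth p 0) * (?T q + g (fps_nth q n) * b ^ n)"
    by (rule arg_cong)
  then have "partial_eval g b (Suc n) (p * q) - partial_eval g b (Suc n) p * partial_eval g b (Suc n) q =
      b * (?T (?s p * q) - ?T (?s p) * ?T q) - b * (?T (?s p) * (g (fps_nth q n) * b ^ n))"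
    unfolding partial_eval_Suc[of _ _ _ "p * q"] partial_eval_Suc[of _ _ _ p] fps_shift_1_mult
      partial_eval_add[OF add] partial_eval_const_mult[OF mult] fps_mult_nth_0 mult q
    by (simp add: algebra_simps)
  also have "b ^ Suc n dvd \<dots>"
    using Suc.IH[of "?s p" q] by (intro dvd_diff) (simp_all add: mult_dvd_mono)
  finally show ?case .
qed

text \<open>The value at \<open>p\<close> is the limit of the truncations. Limits are unique, so
  each law need only be checked modulo every M^n. The coefficient ring is arbitrary so that
  evaluation can be iterated for two variables.\<close>

lemma (in complete_base) fps_eval_hom:
  fixes g :: "'r::comm_ring_1 \<Rightarrow> 'b"
  assumes b: "aug b = 0" and g_one: "g 1 = 1"
    and g_add: "\<And>x y. g (x + y) = g x + g y" and g_mult: "\<And>x y. g (x * y) = g x * g y"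
  obtains f where "\<And>p q. f (p + q) = f p + f q" "\<And>p q. f (p * q) = f p * f q" "f 1 = 1"
    "\<And>c. f (fps_const c) = g c" "f fps_X = b" "\<And>p. aug (f p) = aug (g (fps_nth p 0))"
proof -
  let ?T = "partial_eval g b"
  note sub = subspace_ideal_power[of M]
  have g_zero: "g 0 = 0"
    using g_add[of 0 0] by simp
  have b_power: "b ^ n dvd x \<Longrightarrow> x \<in> ideal_power M n" for x n
    using ideal_scale[OF sub power_in_ideal_power[of b M n]] b
    by (auto simp: mult.commute elim!: dvdE)
  have "\<exists>a. \<forall>n. a - ?T n p \<in> ideal_power M n" for p
    by (rule ideal_power_complete[of "\<lambda>n. ?T n p"]) (auto simp: partial_eval_def intro!: b_power)
  then obtain f where f: "\<And>p n. f p - ?T n p \<in> ideal_power M n" by metis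
  have f_eqI: "f p = a" if "\<And>n. a - ?T n p \<in> ideal_power M n" for p a
  proof (rule ideal_power_separated)
    show "f p - a \<in> ideal_power M n" for n
      using ideal_diff[OF sub f[of p n] that[of n]] by simp
  qed
  show thesis
  proof (rule that[of f])
    show f_const: "f (fps_const c) = g c" for c
    proof (rule f_eqI)
      show "g c - ?T n (fps_const c) \<in> ideal_power M n" for n
        by (cases n) (simp_all only: partial_eval_Suc, simp_all add: partial_eval_def g_zero
            ideal_0[OF sub] del: ideal_power.simps(2))
    qed
    show "f 1 = 1"
      using f_const[of 1] g_one by simp
    show "f (p + q) = f p + f q" for p q
    proof (rule f_eqI)
      show "f p + f q - ?T n (p + q) \<in> ideal_power M n" for n
        using ideal_add[OF sub f f, of p n q]
        by (simp add: partial_eval_add[OF g_add] algebra_simps)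
    qed
    show "f (p * q) = f p * f q" for p q
    proof (rule f_eqI)
      fix n
      have "f p * f q - ?T n (p * q) = f q * (f p - ?T n p) + ?T n p * (f q - ?T n q)
          - (?T n (p * q) - ?T n p * ?T n q)"
        by (simp add: algebra_simps)
      also have "\<dots> \<in> ideal_power M n"
        by (intro ideal_diff[OF sub] ideal_add[OF sub]
            ideal_scale[OF sub] f b_power partial_eval_mult g_add g_mult)
      finally show "f p * f q - ?T n (p * q) \<in> ideal_power M n" .
    qed
    show "f fps_X = b"
    proof (rule f_eqI)
      show "b - ?T n fps_X \<in> ideal_power M n" for n
      \<comment> \<open>The truncations with at most one term miss the linear term of
        \<open>fps_X\<close> and vanish, but for such \<open>n\<close> the element \<open>b\<close>
        itself lies in M^n.\<close>
      proof (cases "n \<le> 1")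
        case True
        then have "n = 0 \<or> n = 1" by auto
        then show ?thesis
          using b_power[of 1 b] by (auto simp: partial_eval_def g_zero)
      next
        case False
        then obtain m where "n = Suc (Suc m)"
          by (metis One_nat_def not_less_eq_eq le0 not0_implies_Suc)
        then show ?thesis
          by (simp only: partial_eval_Suc) (simp add: partial_eval_def g_zero g_one
              ideal_0[OF sub] del: ideal_power.simps(2))
      qed
    qed
    show "aug (f p) = aug (g (fps_nth p 0))" for p
      using f[of p "Suc 0"] ideal_power_1 by (auto simp: partial_eval_def aug_diff)
  qed
qed

section \<open>The base of power series in two variables\<close>

text \<open>The coefficient of \<open>t\<^sup>i s\<^sup>j\<close>.\<close>

abbreviation coeff_ts :: "power_series_ts \<Rightarrow> nat \<Rightarrow> nat \<Rightarrow> complex" where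
  "coeff_ts p i j \<equiv> fps_nth (fps_nth p j) i"

definition order_ge :: "nat \<Rightarrow> power_series_ts set" where
  "order_ge n = {p. \<forall>i j. i + j < n \<longrightarrow> coeff_ts p i j = 0}"

lemma aug_ts_add: "aug_ts (p + q) = aug_ts p + aug_ts q"
  and aug_ts_mult: "aug_ts (p * q) = aug_ts p * aug_ts q"
  and aug_ts_one: "aug_ts 1 = 1"
  and aug_ts_smul_ts: "aug_ts (smul_ts c p) = c * aug_ts p"
  by (simp_all add: aug_ts_def smul_ts_def)

lemma vector_space_smul_ts: "vector_space smul_ts"
proof
  show "smul_ts a (x + y) = smul_ts a x + smul_ts a y" for a x y
    by (simp add: smul_ts_def distrib_left)
  show "smul_ts (a + b) x = smul_ts a x + smul_ts b x" for a b x
    by (simp add: smul_ts_def flip: distrib_right)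
  show "smul_ts a (smul_ts b x) = smul_ts (a * b) x" for a b x
    by (simp add: smul_ts_def flip: mult.assoc)
qed (simp add: smul_ts_def)

section \<open>Powers of the maximal ideal as the filtration by total degree\<close>

lemma order_ge_mult:
  assumes "p \<in> order_ge m" "q \<in> order_ge n"
  shows "p * q \<in> order_ge (m + n)"
proof -
  have "coeff_ts p k l * coeff_ts q (i - k) (j - l) = 0" if "i + j < m + n" "k \<le> i" "l \<le> j" for i j k l
  proof (cases "k + l < m")
    case False
    with that have "(i - k) + (j - l) < n" by linarith
    with assms(2) show ?thesis by (simp add: order_ge_def)
  qed (use assms(1) in \<open>simp add: order_ge_def\<close>)
  then show ?thesis
    by (auto simp: order_ge_def fps_mult_nth fps_sum_nth intro!: sum.neutral)
qed

lemma subspace_order_ge: "module.subspace (*) (order_ge n)"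
proof (rule idealI)
  show "c * p \<in> order_ge n" if "p \<in> order_ge n" for c p
    using order_ge_mult[of c 0 p n] that by (simp add: order_ge_def)
qed (simp_all add: order_ge_def)

text \<open>Shows that t and s generate the maximal ideal: the part without s is divided by t, the
  rest by s.\<close>

lemma power_series_ts_decompose:
  fixes p :: power_series_ts
  shows "smul_ts (aug_ts p) 1 + var_t * fps_const (fps_shift 1 (fps_nth p 0))
    + var_s * fps_shift 1 p = p"
proof -
  have "fps_const (aug_ts p) + fps_X * fps_shift 1 (fps_nth p 0) = fps_nth p 0"
    by (rule fps_ext) (simp add: aug_ts_def)
  then have "smul_ts (aug_ts p) 1 + var_t * fps_const (fps_shift 1 (fps_nth p 0)) =
      fps_const (fps_nth p 0)"
    by (simp add: smul_ts_def)
  moreover have "fps_const (fps_nth p 0) + var_s * fps_shift 1 p = p"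
    by (rule fps_ext) simp
  ultimately show ?thesis by metis
qed

text \<open>A series of order at least n + 1 has no constant term, so it equals t q + s r, and
  division by a variable lowers the order by one only.\<close>

lemma ideal_power_ts: "ideal_power {p. aug_ts p = 0} n = order_ge n"
proof (induction n)
  case 0
  then show ?case by (simp add: order_ge_def)
next
  case (Suc n)
  have M: "{p. aug_ts p = 0} = order_ge 1"
    by (auto simp: order_ge_def aug_ts_def)
  show ?case
  proof
    show "ideal_power {p. aug_ts p = 0} (Suc n) \<subseteq> order_ge (Suc n)"
      unfolding ideal_power.simps Suc unfolding M
      using order_ge_mult[of _ 1 _ n]
      by (intro ideal_span_minimal subspace_order_ge) auto
  next
    show "order_ge (Suc n) \<subseteq> ideal_power {p. aug_ts p = 0} (Suc n)"
    proof
      fix p assume p: "p \<in> order_ge (Suc n)"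
      let ?q = "fps_const (fps_shift 1 (fps_nth p 0))" and ?r = "fps_shift 1 p"
      have "aug_ts p = 0"
        using p by (simp add: order_ge_def aug_ts_def)
      then have p_eq: "var_t * ?q + var_s * ?r = p"
        using power_series_ts_decompose[of p] by (simp add: smul_ts_def)
      have "?q \<in> order_ge n" "?r \<in> order_ge n"
        using p by (auto simp: order_ge_def)
      moreover have "aug_ts var_t = 0" "aug_ts var_s = 0"
        by (simp_all add: aug_ts_def)
      ultimately show "p \<in> ideal_power {p. aug_ts p = 0} (Suc n)"
        by (subst p_eq[symmetric]) (intro ideal_add[OF subspace_ideal_power] ideal_power_mult,
            simp_all only: Suc mem_Collect_eq)
    qed
  qed
qed

section \<open>The power series ring is local, with finite dimensional graded pieces, and
  complete\<close>

lemma aug_ts_nonzero_imp_unit: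
  assumes "aug_ts p \<noteq> 0"
  shows "\<exists>q. p * q = 1"
proof -
  have "fps_nth p 0 * inverse (fps_nth p 0) = 1"
    using inverse_mult_eq_1'[of "fps_nth p 0"] assms by (simp add: aug_ts_def)
  then have "p * fps_right_inverse p (inverse (fps_nth p 0)) = 1"
    by (rule fps_right_inverse)
  then show ?thesis ..
qed

text \<open>Series with nonzero constant term are units, so every proper ideal is contained in the
  kernel of the augmentation.\<close>

lemma maximal_ideal_ts: "maximal_ideal I \<longleftrightarrow> I = {p. aug_ts p = 0}"
proof -
  let ?M = "{p. aug_ts p = 0}"
  have proper: "J = UNIV \<or> J \<subseteq> ?M" if "module.subspace (*) J" for J
  proof (rule disjCI)
    assume "\<not> J \<subseteq> ?M"
    then obtain p q where "p \<in> J" "p * q = 1"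
      using aug_ts_nonzero_imp_unit by blast
    then have "x \<in> J" for x
      using ideal_scale[OF that \<open>p \<in> J\<close>, of "x * q"]
      by (simp add: mult.assoc mult.commute[of q])
    then show "J = UNIV" by blast
  qed
  have sub: "module.subspace (*) ?M"
    using subspace_ideal_power[of ?M 1] subspace_order_ge[of 1]
    by (simp add: order_ge_def aug_ts_def)
  have ne: "?M \<noteq> UNIV"
    using aug_ts_one by (metis UNIV_I mem_Collect_eq zero_neq_one)
  show ?thesis
  proof
    assume "maximal_ideal I"
    then have I: "module.subspace (*) I" "I \<noteq> UNIV"
      "\<And>J. module.subspace (*) J \<Longrightarrow> I \<subseteq> J \<Longrightarrow> J = I \<or> J = UNIV"
      unfolding maximal_ideal_def by simp_all
    show "I = ?M"
      using I(3)[OF sub] proper[OF I(1)] I(2) ne by argo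
  next
    assume I: "I = ?M"
    show "maximal_ideal I"
      unfolding maximal_ideal_def I using sub ne proper by (simp only: simp_thms) fast
  qed
qed

definition monomial_ts :: "nat \<Rightarrow> nat \<Rightarrow> power_series_ts" where
  "monomial_ts i j = Abs_fps (\<lambda>j'. Abs_fps (\<lambda>i'. if i' = i \<and> j' = j then 1 else 0))"

lemma coeff_monomial_ts: "coeff_ts (monomial_ts i j) i' j' = (if i' = i \<and> j' = j then 1 else 0)"
  by (simp add: monomial_ts_def)

lemma order_ge_finite_dim:
  "\<exists>B. finite B \<and> B \<subseteq> order_ge k \<and>
     (\<forall>p \<in> order_ge k. \<exists>b \<in> module.span smul_ts B. p - b \<in> order_ge (Suc k))"
proof -
  interpret vector_space smul_ts by (rule vector_space_smul_ts)
  let ?B = "(\<lambda>i. monomial_ts i (k - i)) ` {..k}"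
  have "\<exists>b \<in> module.span smul_ts ?B. p - b \<in> order_ge (Suc k)" if p: "p \<in> order_ge k" for p
  proof
    \<comment> \<open>The homogeneous part of degree \<open>k\<close> of \<open>p\<close>.\<close>
    let ?b = "\<Sum>i\<le>k. smul_ts (coeff_ts p i (k - i)) (monomial_ts i (k - i))"
    show "?b \<in> span ?B"
      by (intro span_sum span_scale span_base) simp
    have "coeff_ts ?b i j = coeff_ts p i j" if "i + j < Suc k" for i j
    proof -
      have "coeff_ts ?b i j = (\<Sum>l\<le>k. if l = i \<and> j = k - l then coeff_ts p l (k - l) else 0)"
        by (auto simp: fps_sum_nth smul_ts_def coeff_monomial_ts intro!: sum.cong)
      also have "\<dots> = (\<Sum>l\<le>k. if l = i then (if j = k - i then coeff_ts p i j else 0) else 0)"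
        by (rule sum.cong) auto
      also have "\<dots> = coeff_ts p i j"
        using that p by (auto simp: order_ge_def)
      finally show ?thesis .
    qed
    then show "p - ?b \<in> order_ge (Suc k)"
      by (simp add: order_ge_def)
  qed
  moreover have "?B \<subseteq> order_ge k"
    by (auto simp: order_ge_def coeff_monomial_ts)
  ultimately show ?thesis by blast
qed

lemma base_ts: "base smul_ts aug_ts"
proof -
  interpret vector_space smul_ts by (rule vector_space_smul_ts)
  show ?thesis
  proof unfold_locales
    show "\<exists>B. finite B \<and> B \<subseteq> ideal_power {x. aug_ts x = 0} k \<and>
      (\<forall>x\<in>ideal_power {x. aug_ts x = 0} k. \<exists>b\<in>span B. x - b \<in> ideal_power {x. aug_ts x = 0} (Suc k))" for k
      unfolding ideal_power_ts by (rule order_ge_finite_dim)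
    show "smul_ts c (x * y) = smul_ts c x * y" for c x y
      by (simp add: smul_ts_def mult.assoc)
    show "aug_ts (smul_ts c x) = c * aug_ts x" for c x
      by (rule aug_ts_smul_ts)
  qed (simp_all add: aug_ts_add aug_ts_mult aug_ts_one maximal_ideal_ts algebra_simps)
qed

lemma complete_base_ts: "complete_base smul_ts aug_ts"
proof -
  let ?F = "\<lambda>a n. (+) a ` order_ge n"
  let ?S = "{X. (\<forall>n. \<exists>a. X n = (+) a ` order_ge n) \<and> (\<forall>n. X (Suc n) \<subseteq> X n)}"
  note eq_iff = translate_subgroup_eq_iff[OF subspace_order_ge]
  have "bij_betw ?F UNIV ?S"
    unfolding bij_betw_def
  proof
    show "inj ?F"
    proof (rule injI)
      fix p q assume "?F p = ?F q"
      then have "p - q \<in> order_ge n" for n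
        by (simp add: fun_eq_iff eq_iff)
      then have "coeff_ts (p - q) i j = 0" for i j
        unfolding order_ge_def using less_Suc_eq by blast
      then show "p = q"
        by (simp add: fps_eq_iff)
    qed
    show "range ?F = ?S"
    proof
      show "range ?F \<subseteq> ?S"
        by (auto simp: order_ge_def)
      show "?S \<subseteq> range ?F"
      proof
        fix X assume X: "X \<in> ?S"
        then obtain a where a: "\<And>n. X n = (+) (a n) ` order_ge n"
          by (simp only: mem_Collect_eq) metis
        have step: "a (Suc n) - a n \<in> order_ge n" for n
        proof -
          have "a (Suc n) + 0 \<in> X (Suc n)"
            unfolding a using ideal_0[OF subspace_order_ge] by blast
          moreover have "X (Suc n) \<subseteq> X n"
            using X by simp
          ultimately have "a (Suc n) + 0 \<in> (+) (a n) ` order_ge n"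
            unfolding a by blast
          then show ?thesis by auto
        qed
        \<comment> \<open>Later corrections have order at least i + j + 1, so the coefficient of
          degree i + j no longer changes; the limit is defined by these stable values.\<close>
        have stable: "coeff_ts (a m) i j = coeff_ts (a (Suc (i + j))) i j" if "Suc (i + j) \<le> m" for m i j
          using that
        proof (induction m rule: dec_induct)
          case (step m)
          with \<open>\<And>n. a (Suc n) - a n \<in> order_ge n\<close>[of m] show ?case
            by (simp add: order_ge_def)
        qed simp
        define p :: power_series_ts where
          "p = Abs_fps (\<lambda>j. Abs_fps (\<lambda>i. coeff_ts (a (Suc (i + j))) i j))"
        have "p - a n \<in> order_ge n" for n
          using stable[of _ _ n] by (simp add: order_ge_def p_def)
        then have "X n = ?F p n" for n
          unfolding a using eq_iff[of p n "a n"] by blast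
        then have "X = ?F p" by blast
        then show "X \<in> range ?F" by blast
      qed
    qed
  qed
  then show ?thesis
    unfolding complete_base_def complete_base_axioms_def ideal_power_ts using base_ts by blast
qed

section \<open>The brackets deforming the algebra\<close>

text \<open>The bracket with [e1,e3] = e2 + a e1, [e2,e3] = b e1 and [e3,e3] = e1. One family
  contains \<open>lambda6\<close>, \<open>lambda6_ts\<close> and all push-outs of the
  latter.\<close>

definition lambda6_deformed :: "'a \<Rightarrow> 'a \<Rightarrow> 'a ^ 3 \<Rightarrow> 'a ^ 3 \<Rightarrow> ('a::comm_ring_1) ^ 3" where
  "lambda6_deformed a b v w = vector [(v $ 3 + a * v $ 1 + b * v $ 2) * w $ 3, v $ 1 * w $ 3, 0]"

lemma vec3_eq_iff: "v = w \<longleftrightarrow> v $ 1 = w $ 1 \<and> v $ 2 = w $ 2 \<and> v $ 3 = (w :: 'a ^ 3) $ 3"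
  by (simp add: vec_eq_iff forall_3)

lemma lambda6_deformed_nth [simp]:
  "lambda6_deformed a b v w $ 1 = (v $ 3 + a * v $ 1 + b * v $ 2) * w $ 3"
  "lambda6_deformed a b v w $ 2 = v $ 1 * w $ 3"
  "lambda6_deformed a b v w $ 3 = 0"
  by (simp_all add: lambda6_deformed_def)

lemma axis3_nth [simp]:
  "axis (1::3) x $ (1::3) = x" "axis (1::3) x $ (2::3) = 0" "axis (1::3) x $ (3::3) = 0"
  "axis (2::3) x $ (1::3) = 0" "axis (2::3) x $ (2::3) = x" "axis (2::3) x $ (3::3) = 0"
  "axis (3::3) x $ (1::3) = 0" "axis (3::3) x $ (2::3) = 0" "axis (3::3) x $ (3::3) = x"
  by (simp_all add: axis_def)

lemma map_coeffs_nth [simp]: "map_coeffs f v $ i = f (v $ i)"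
  by (simp add: map_coeffs_def)

lemma module_vec: "module ((*s) :: 'a::comm_ring_1 \<Rightarrow> 'a ^ 'n \<Rightarrow> 'a ^ 'n)"
  by unfold_locales (simp_all add: vec_eq_iff algebra_simps)

text \<open>Only the third coordinate of the right argument matters, and brackets have third
  coordinate 0. So [x,[y,z]] = 0, while [[x,y],z] is symmetric in y and z.\<close>

lemma leibniz_lambda6_deformed: "leibniz_algebra (*s) (lambda6_deformed a b)"
proof -
  interpret module "(*s) :: 'a \<Rightarrow> 'a ^ 3 \<Rightarrow> 'a ^ 3" by (rule module_vec)
  show ?thesis
    by unfold_locales (simp_all add: vec3_eq_iff algebra_simps)
qed

lemma lambda6_eq: "lambda6 = lambda6_deformed 0 0"
  by (intro ext) (simp add: lambda6_def bilinear_extension_def vec3_eq_iff sum_3)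

lemma lambda6_ts_eq: "lambda6_ts = lambda6_deformed var_s (- var_t)"
  by (intro ext) (simp add: lambda6_ts_def bilinear_extension_def vec3_eq_iff sum_3 algebra_simps)

lemma push_out_lambda6_deformed:
  assumes "f 0 = 0" "f 1 = 1"
  shows "push_out f (lambda6_deformed a b) = lambda6_deformed (f a) (f b)"
  by (intro ext) (simp add: push_out_def bilinear_extension_def vec3_eq_iff sum_3 assms algebra_simps)

lemma formal_deformation_lambda6_ts: "formal_deformation smul_ts aug_ts lambda6 lambda6_ts"
proof -
  have "aug_ts (- p) = - aug_ts p" for p
    by (simp add: aug_ts_def)
  then have "deformation_axioms aug_ts lambda6 lambda6_ts"
    unfolding lambda6_eq lambda6_ts_eq
    by unfold_locales (simp add: vec3_eq_iff aug_ts_def)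
  then show ?thesis
    unfolding formal_deformation_def deformation_def
    using base_ts complete_base_ts leibniz_lambda6_deformed lambda6_eq lambda6_ts_eq by metis
qed

subsection \<open>Classification over a complete base\<close>

text \<open>The change of basis e1 to \<open>g1\<close>, e2 to \<open>g2\<close> that keeps
  e3.\<close>

definition basis_map :: "'a ^ 3 \<Rightarrow> 'a ^ 3 \<Rightarrow> 'a ^ 3 \<Rightarrow> ('a::comm_ring_1) ^ 3" where
  "basis_map g1 g2 y = y $ 1 *s g1 + y $ 2 *s g2 + y $ 3 *s axis 3 1"

lemma module_hom_basis_map: "module_hom (*s) (*s) (basis_map g1 g2)"
  unfolding module_hom_iff
  by (simp add: module_vec basis_map_def vec3_eq_iff algebra_simps)

lemma bij_basis_map:
  assumes inv: "(g1 $ 1 * g2 $ 2 - g1 $ 2 * g2 $ 1) * d = 1"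
  shows "bij (basis_map g1 g2)"
proof (rule o_bij)
  \<comment> \<open>Cramer's rule\<close>
  let ?G = "\<lambda>x. let y1 = d * (g2 $ 2 * x $ 1 - g2 $ 1 * x $ 2); y2 = d * (g1 $ 1 * x $ 2 - g1 $ 2 * x $ 1)
    in vector [y1, y2, x $ 3 - g1 $ 3 * y1 - g2 $ 3 * y2] :: 'a ^ 3"
  let ?D = "(g1 $ 1 * g2 $ 2 - g1 $ 2 * g2 $ 1) * d"
  have "d * (g2 $ 2 * x1 - g2 $ 1 * x2) * g1 $ 1 + d * (g1 $ 1 * x2 - g1 $ 2 * x1) * g2 $ 1 = ?D * x1"
    "d * (g2 $ 2 * x1 - g2 $ 1 * x2) * g1 $ 2 + d * (g1 $ 1 * x2 - g1 $ 2 * x1) * g2 $ 2 = ?D * x2"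
    "y1 * g1 $ 3 + y2 * g2 $ 3 + (x3 - g1 $ 3 * y1 - g2 $ 3 * y2) = x3" for x1 x2 x3 y1 y2
    by (simp_all add: algebra_simps)
  then show "basis_map g1 g2 \<circ> ?G = id"
    unfolding inv by (simp add: fun_eq_iff vec3_eq_iff basis_map_def Let_def)
  have "d * (g2 $ 2 * (y1 * g1 $ 1 + y2 * g2 $ 1) - g2 $ 1 * (y1 * g1 $ 2 + y2 * g2 $ 2)) = ?D * y1"
    "d * (g1 $ 1 * (y1 * g1 $ 2 + y2 * g2 $ 2) - g1 $ 2 * (y1 * g1 $ 1 + y2 * g2 $ 1)) = ?D * y2" for y1 y2
    by (simp_all add: algebra_simps)
  then show "?G \<circ> basis_map g1 g2 = id"
    unfolding inv by (simp add: fun_eq_iff vec3_eq_iff basis_map_def Let_def)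
qed

lemma (in base) smul_one_mult: "smul (c * d) 1 = smul c 1 * smul d 1"
  by (simp flip: smul_mult)

text \<open>Geometric series: the inverse of 1 - X is evaluated at 1 - x, which lies in the maximal
  ideal.\<close>

lemma (in complete_base) aug_one_imp_unit:
  assumes "aug x = 1"
  shows "\<exists>y. x * y = 1"
proof -
  have "aug (1 - x) = 0"
    using assms by (simp add: aug_diff aug_one)
  then obtain f where f: "\<And>p q :: 'a fps. f (p + q) = f p + f q" "\<And>p q. f (p * q) = f p * f q"
      "f 1 = 1" "\<And>c. f (fps_const c) = smul c 1" "f fps_X = 1 - x"
      "\<And>p. aug (f p) = aug (smul (fps_nth p 0) 1)"
    using scale_one scale_left_distrib smul_one_mult
    by (rule fps_eval_hom[where g = "\<lambda>c. smul c 1"]) (rule that)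
  have "f (1 - fps_X) = x"
    using f(1)[of "1 - fps_X" fps_X] f(3,5) by (simp add: algebra_simps)
  moreover have "(1 - fps_X) * inverse (1 - fps_X) = (1 :: 'a fps)"
    by (rule inverse_mult_eq_1') simp
  ultimately show ?thesis
    using f(2,3) by metis
qed

lemma (in complete_base) bij_basis_map_aug:
  assumes "map_coeffs aug g1 = axis 1 1" "map_coeffs aug g2 = axis 2 1"
  shows "bij (basis_map g1 g2)"
proof -
  have "aug (g1 $ 1 * g2 $ 2 - g1 $ 2 * g2 $ 1) = 1"
    using assms by (simp add: vec3_eq_iff aug_diff aug_mult)
  then show ?thesis
    using aug_one_imp_unit bij_basis_map by blast
qed

lemma (in base) map_coeffs_aug_basis_map:
  assumes "map_coeffs aug g1 = axis 1 1" "map_coeffs aug g2 = axis 2 1"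
  shows "map_coeffs aug (basis_map g1 g2 y) = map_coeffs aug y"
  using assms by (simp add: vec3_eq_iff basis_map_def aug_add aug_mult aug_one aug_zero)

text \<open>Modulo the maximal ideal \<open>R\<close> is right multiplication by e3 in
  \<open>lambda6\<close>, which sends e3 to e1, e1 to e2 and e2 to 0.\<close>

lemma deformation_lambda6_aug:
  assumes "deformation smul aug lambda6 D"
  defines "R \<equiv> \<lambda>x. D x (axis 3 1)"
  shows "map_coeffs aug (R (axis 3 1)) = axis 1 1"
    and "map_coeffs aug (R (R (axis 3 1))) = axis 2 1"
    and "map_coeffs aug (R (R (R (axis 3 1)))) = 0"
proof -
  interpret deformation smul aug lambda6 D by fact
  have e3: "map_coeffs aug (axis 3 1) = axis (3::3) 1"
    by (simp add: vec3_eq_iff aug_one aug_zero)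
  show "map_coeffs aug (R (axis 3 1)) = axis 1 1"
    and "map_coeffs aug (R (R (axis 3 1))) = axis 2 1"
    and "map_coeffs aug (R (R (R (axis 3 1)))) = 0"
    by (simp_all add: R_def aug_bracket e3 lambda6_eq vec3_eq_iff)
qed

lemma formal_deformation_lambda6_equivalent:
  fixes D :: "'b ^ 3 \<Rightarrow> 'b ^ 3 \<Rightarrow> ('b::comm_ring_1) ^ 3"
  assumes D: "formal_deformation smul aug lambda6 D"
  obtains a b where "aug a = 0" "aug b = 0" "equivalent_deformations aug D (lambda6_deformed a b)"
proof -
  interpret formal_deformation smul aug lambda6 D by (rule D)
  define e3 :: "'b ^ 3" where "e3 = axis 3 1"
  define f1 where "f1 = D e3 e3"
  define f2 where "f2 = D f1 e3"
  define f3 where "f3 = D f2 e3"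
  note left = module_hom.add[OF total.linear_left] module_hom.scale[OF total.linear_left]
    module_hom.diff[OF total.linear_left] module_hom.zero[OF total.linear_left]
  note right = module_hom.add[OF total.linear_right] module_hom.scale[OF total.linear_right]
    module_hom.diff[OF total.linear_right] module_hom.zero[OF total.linear_right]
  \<comment> \<open>With y = z the two terms on the right of the Leibniz identity cancel; in the
    next two steps each term contains a bracket already known to vanish.\<close>
  have f1_right: "D x f1 = 0" for x
    unfolding f1_def by (subst total.leibniz) simp
  have f2_right: "D x f2 = 0" for x
    unfolding f2_def by (subst total.leibniz) (simp add: f1_right left)
  have f3_right: "D x f3 = 0" for x
    unfolding f3_def by (subst total.leibniz) (simp add: f2_right left)
  have aug_f1: "map_coeffs aug f1 = axis 1 1" and aug_f2: "map_coeffs aug f2 = axis 2 1"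
    and aug_f3: "map_coeffs aug f3 = 0"
    unfolding f3_def f2_def f1_def e3_def by (rule deformation_lambda6_aug[OF deformation_axioms])+
  have bij: "bij (basis_map f1 f2)"
    by (rule bij_basis_map_aug[OF aug_f1 aug_f2])
  obtain y where y: "basis_map f1 f2 y = f3"
    using bij_is_surj[OF bij] by (metis surjD)
  define a b where "a = y $ 2" and "b = y $ 1"
  have y3: "y $ 3 = 0"
  proof -
    \<comment> \<open>Bracketing with e3 from the left kills \<open>f1\<close> and
      \<open>f2\<close>, which isolates the e3-coefficient of \<open>f3\<close> as a multiple of the
      basis vector \<open>f1\<close>.\<close>
    have "0 = D e3 f3"
      by (simp add: f3_right)
    also have "\<dots> = y $ 3 *s f1"
      unfolding y[symmetric] basis_map_def e3_def[symmetric]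
      by (simp only: right f1_right f2_right f1_def[symmetric]) simp
    finally have "basis_map f1 f2 (axis 1 (y $ 3)) = basis_map f1 f2 0"
      by (simp add: basis_map_def)
    then have "axis 1 (y $ 3) = (0 :: 'b ^ 3)"
      using bij_is_inj[OF bij] by (simp add: inj_eq)
    then show ?thesis by (simp add: vec3_eq_iff)
  qed
  then have f3: "f3 = a *s f2 + b *s f1"
    unfolding y[symmetric] by (simp add: basis_map_def a_def b_def add.commute)
  have "map_coeffs aug y = 0"
    using map_coeffs_aug_basis_map[OF aug_f1 aug_f2, of y] y aug_f3 by simp
  then have aug: "aug a = 0" "aug b = 0"
    by (simp_all add: vec3_eq_iff a_def b_def)
  \<comment> \<open>the second basis vector is \<open>f2 - a f1\<close>, since \<open>[e1, e3] = e2 + a e1\<close> in the target\<close>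
  let ?E = "basis_map f1 (f2 - a *s f1)"
  have aug_g2: "map_coeffs aug (f2 - a *s f1) = axis 2 1"
    using aug_f2 by (simp add: vec3_eq_iff aug_diff aug_mult aug)
  have bij_E: "bij ?E"
    by (rule bij_basis_map_aug[OF aug_f1 aug_g2])
  have E_e3: "D x (?E w) = w $ 3 *s D x e3" for x w
    unfolding basis_map_def e3_def[symmetric]
    by (simp only: right f1_right f2_right) simp
  \<comment> \<open>The second basis vector is sent to \<open>f3 - a *s f2\<close>, which is
    \<open>b *s f1\<close>.\<close>
  have "D (?E v) e3 = (v $ 3 + b * v $ 2) *s f1 + v $ 1 *s f2" for v
    unfolding basis_map_def e3_def[symmetric]
    by (simp only: left f1_def[symmetric] f2_def[symmetric] f3_def[symmetric] f3)
      (simp add: vec3_eq_iff algebra_simps)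
  then have hom: "?E (lambda6_deformed a b v w) = D (?E v) (?E w)" for v w
    unfolding E_e3 by (simp add: basis_map_def vec3_eq_iff algebra_simps)
  have inv: "?E (inv ?E v) = v" for v
    using bij_E by (simp add: bij_is_surj surj_f_inv_f)
  \<comment> \<open>\<open>?E\<close> leads from the normal form to \<open>D\<close>, hence the
    equivalence is its inverse.\<close>
  have "equivalent_deformations aug D (lambda6_deformed a b)"
    unfolding equivalent_deformations_def
  proof (intro exI[of _ "inv ?E"] conjI allI)
    show "module_hom (*s) (*s) (inv ?E)"
      by (rule bij_module_hom_imp_inv_module_hom[OF module_hom_basis_map bij_E])
    show "bij (inv ?E)"
      by (rule bij_imp_bij_inv[OF bij_E])
    show "inv ?E (D v w) = lambda6_deformed a b (inv ?E v) (inv ?E w)" for v w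
    proof -
      have "D v w = ?E (lambda6_deformed a b (inv ?E v) (inv ?E w))"
        by (simp only: hom inv)
      then show ?thesis
        by (simp only: inv_f_f[OF bij_is_inj[OF bij_E]])
    qed
    show "map_coeffs aug (inv ?E v) = map_coeffs aug v" for v
      using map_coeffs_aug_basis_map[OF aug_f1 aug_g2, of "inv ?E v"] by (simp add: inv)
  qed
  with aug show thesis by (rule that)
qed

section \<open>Homomorphisms from the power series ring\<close>

lemma base_hom_ts_exists:
  assumes "complete_base smul aug" "aug a = 0" "aug b = 0"
  obtains f where "base_hom smul_ts aug_ts smul aug f" "f var_s = a" "f var_t = b"
proof -
  interpret complete_base smul aug by (rule assms(1))
  \<comment> \<open>First the series in t alone are evaluated at \<open>b\<close>; this map then
    acts on the coefficients when s is evaluated at \<open>a\<close>.\<close>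
  obtain g where g: "\<And>p q. g (p + q) = g p + g q" "\<And>p q. g (p * q) = g p * g q" "g 1 = 1"
    "\<And>c. g (fps_const c) = smul c 1" "g fps_X = b" "\<And>p. aug (g p) = aug (smul (fps_nth p 0) 1)"
    using assms(3) scale_one scale_left_distrib smul_one_mult
    by (rule fps_eval_hom[where g = "\<lambda>c. smul c 1"]) (rule that)
  obtain f where f: "\<And>p q. f (p + q) = f p + f q" "\<And>p q. f (p * q) = f p * f q" "f 1 = 1"
    "\<And>c. f (fps_const c) = g c" "f fps_X = a" "\<And>p. aug (f p) = aug (g (fps_nth p 0))"
    using assms(2) g(3,1,2) by (rule fps_eval_hom) (rule that)
  interpret ts: base smul_ts aug_ts by (rule base_ts)
  have "base_hom smul_ts aug_ts smul aug f"
  proof unfold_locales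
    show "f (smul_ts c p) = smul c (f p)" for c p
      by (simp add: smul_ts_def f(2,4) g(4) flip: smul_mult)
    show "aug (f p) = aug_ts p" for p
      by (simp add: f(6) g(6) aug_smul aug_one aug_ts_def)
  qed (rule f)+
  then show thesis
    using that f(4,5) g(5) by metis
qed

subsection \<open>Uniqueness over an infinitesimal base\<close>

text \<open>\<open>p\<close> differs from its augmentation by an element of M, whose product with
  \<open>x\<close> lies in M^2 = 0.\<close>

lemma (in base) infinitesimal_mult:
  assumes "ideal_power M 2 = {0}" "aug x = 0"
  shows "p * x = smul (aug p) x"
proof -
  have "x * 1 \<in> ideal_power M 1"
    using ideal_power_mult[of x M 1 0] assms(2) by simp
  moreover have "aug (p - smul (aug p) 1) = 0"
    by (simp add: aug_diff aug_smul aug_one)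
  ultimately have "(p - smul (aug p) 1) * x \<in> ideal_power M 2"
    using ideal_power_mult[of "p - smul (aug p) 1" M x 1] by (simp add: numeral_2_eq_2)
  then show ?thesis
    using assms(1) by (simp add: left_diff_distrib flip: smul_mult)
qed

text \<open>The equivalence carries \<open>R\<close> to the bracket with x = \<phi>(e3), that is, to
  \<open>x $ 3\<close> times N, the bracket with e3. As N^3 = a N^2 + b N, the cube relation
  acquires only factors \<open>x $ 3\<close> next to \<open>a\<close> and \<open>b\<close>. These
  have augmentation 1 and disappear because M^2 = 0.\<close>

lemma equivalent_lambda6_deformed_cube:
  assumes "base smul aug" and sq: "ideal_power {x. aug x = 0} 2 = {0}" and "aug a = 0" "aug b = 0"
    and eq: "equivalent_deformations aug D (lambda6_deformed a b)"
  defines "R \<equiv> \<lambda>x. D x (axis 3 1)"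
  shows "R (R (R (axis 3 1))) = a *s R (R (axis 3 1)) + b *s R (axis 3 1)"
proof -
  interpret base smul aug by fact
  obtain \<phi> where \<phi>: "module_hom (*s) (*s) \<phi>" "bij \<phi>"
    "\<And>v w. \<phi> (D v w) = lambda6_deformed a b (\<phi> v) (\<phi> w)"
    "\<And>v. map_coeffs aug (\<phi> v) = map_coeffs aug v"
    using eq unfolding equivalent_deformations_def by blast
  define x where "x = \<phi> (axis 3 1)"
  have aug_x: "aug (x $ 3) = 1"
    using \<phi>(4)[of "axis 3 1"] by (simp add: x_def vec3_eq_iff aug_one)
  have a: "a * x $ 3 = a" and b: "b * x $ 3 = b"
    using infinitesimal_mult[OF sq, of _ "x $ 3"] assms(3,4) aug_x
    by (simp_all add: mult.commute)
  let ?B = "\<lambda>v. lambda6_deformed a b v x"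
  have R: "\<phi> (R v) = ?B (\<phi> v)" for v
    by (simp add: R_def \<phi>(3) x_def)
  have absorb: "c * (x $ 3 * z) = c * z" "c * (y * x $ 3) = c * y" "c * (y * (x $ 3 * z)) = c * (y * z)"
    if c: "c * x $ 3 = c" for c y z
  proof -
    have "c * (x $ 3 * z) = (c * x $ 3) * z" "c * (y * x $ 3) = (c * x $ 3) * y"
      "c * (y * (x $ 3 * z)) = (c * x $ 3) * (y * z)"
      by (simp_all only: mult_ac)
    then show "c * (x $ 3 * z) = c * z" "c * (y * x $ 3) = c * y" "c * (y * (x $ 3 * z)) = c * (y * z)"
      by (simp_all only: c)
  qed
  have "a * a = 0" "a * b = 0" "b * b = 0"
    using infinitesimal_mult[OF sq assms(3), of a] infinitesimal_mult[OF sq assms(4), of a]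
      infinitesimal_mult[OF sq assms(4), of b] assms(3,4) by simp_all
  then have zero: "a * a = 0" "a * b = 0" "b * b = 0"
    "a * (a * z) = 0" "a * (b * z) = 0" "b * (b * z) = 0" for z
    by (simp_all flip: mult.assoc)
  have "?B (?B (?B x)) = a *s ?B (?B x) + b *s ?B x"
    by (simp add: vec3_eq_iff) (simp add: algebra_simps a b absorb[OF a] absorb[OF b] zero)
  then have "\<phi> (R (R (R (axis 3 1)))) = \<phi> (a *s R (R (axis 3 1)) + b *s R (axis 3 1))"
    by (simp add: R module_hom.add[OF \<phi>(1)] module_hom.scale[OF \<phi>(1)] flip: x_def)
  then show ?thesis
    using \<phi>(2) by (simp add: bij_is_inj inj_eq)
qed

text \<open>Both pairs express the same vector in \<open>f2\<close> and \<open>f1\<close>. Elements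
  of M see only the augmentations e2 and e1 of these vectors, so the coefficients are read off as
  coordinates.\<close>

lemma equivalent_lambda6_deformed_unique:
  fixes D :: "'b ^ 3 \<Rightarrow> 'b ^ 3 \<Rightarrow> ('b::comm_ring_1) ^ 3"
  assumes D: "deformation smul aug lambda6 D" and sq: "ideal_power {x. aug x = 0} 2 = {0}"
    and a: "aug a = 0" "aug b = 0" "equivalent_deformations aug D (lambda6_deformed a b)"
    and a': "aug a' = 0" "aug b' = 0" "equivalent_deformations aug D (lambda6_deformed a' b')"
  shows "a = a' \<and> b = b'"
proof -
  interpret deformation smul aug lambda6 D by (rule D)
  define f1 where "f1 = D (axis 3 1) (axis 3 1)"
  define f2 where "f2 = D f1 (axis 3 1)"
  have aug_f1: "map_coeffs aug f1 = axis 1 1" and aug_f2: "map_coeffs aug f2 = axis 2 1"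
    unfolding f2_def f1_def by (rule deformation_lambda6_aug[OF D])+
  have scale: "x * p = smul (aug p) x" if "aug x = 0" for x p
    using infinitesimal_mult[OF sq that] by (simp add: mult.commute)
  have "a *s f2 + b *s f1 = a' *s f2 + b' *s f1"
    using equivalent_lambda6_deformed_cube[OF base_axioms sq a]
      equivalent_lambda6_deformed_cube[OF base_axioms sq a']
    by (simp add: f1_def f2_def)
  with aug_f1 aug_f2 a(1,2) a'(1,2) show ?thesis
    by (simp add: vec3_eq_iff scale)
qed

text \<open>After splitting p into its constant term, a multiple of t and a multiple of s, the
  cofactors act on the images of t and s through their constant terms alone.\<close>

lemma base_hom_ts_eqI:
  assumes "base_hom smul_ts aug_ts smul aug f" "base_hom smul_ts aug_ts smul aug g"
    and sq: "ideal_power {x. aug x = 0} 2 = {0}"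
    and "f var_s = g var_s" "f var_t = g var_t"
  shows "f = g"
proof
  fix p :: power_series_ts
  let ?q = "fps_const (fps_shift 1 (fps_nth p 0))" and ?r = "fps_shift 1 p"
  have expand: "h p = smul (aug_ts p) 1 + smul (aug_ts ?q) (h var_t) + smul (aug_ts ?r) (h var_s)"
    if h: "base_hom smul_ts aug_ts smul aug h" for h
  proof -
    interpret h: base_hom smul_ts aug_ts smul aug h by fact
    have "aug (h var_t) = 0" "aug (h var_s) = 0"
      by (simp_all add: h.aug_compat aug_ts_def)
    then have "h var_t * h ?q = smul (aug_ts ?q) (h var_t)" "h var_s * h ?r = smul (aug_ts ?r) (h var_s)"
      using h.target.infinitesimal_mult[OF sq] by (simp_all add: mult.commute h.aug_compat)
    moreover have "h p = h (smul_ts (aug_ts p) 1 + var_t * ?q + var_s * ?r)"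
      by (simp only: power_series_ts_decompose)
    ultimately show ?thesis
      by (simp only: h.add h.mult h.scale h.one)
  qed
  show "f p = g p"
    using expand[OF assms(1)] expand[OF assms(2)] assms(4,5) by simp
qed

section \<open>Versality\<close>

lemma versal_lambda6_ts: "versal TYPE('a::comm_ring_1) smul_ts aug_ts lambda6 lambda6_ts"
  unfolding versal_def
proof (intro conjI allI impI)
  show "formal_deformation smul_ts aug_ts lambda6 lambda6_ts"
    by (rule formal_deformation_lambda6_ts)
next
  fix smul :: "complex \<Rightarrow> 'a \<Rightarrow> 'a" and aug D
  assume D: "formal_deformation smul aug lambda6 D"
  interpret formal_deformation smul aug lambda6 D by (rule D)
  have push_out: "push_out f lambda6_ts = lambda6_deformed (f var_s) (- f var_t)"
    and aug_f: "aug (f var_s) = 0" "aug (- f var_t) = 0"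
    if "base_hom smul_ts aug_ts smul aug f" for f
  proof -
    interpret f: base_hom smul_ts aug_ts smul aug f by (rule that)
    show "push_out f lambda6_ts = lambda6_deformed (f var_s) (- f var_t)"
      unfolding lambda6_ts_eq by (simp only: push_out_lambda6_deformed[OF f.zero f.one] f.neg)
    show "aug (f var_s) = 0" "aug (- f var_t) = 0"
      by (simp_all add: f.aug_compat aug_minus aug_ts_def)
  qed
  obtain a b where ab: "aug a = 0" "aug b = 0" "equivalent_deformations aug D (lambda6_deformed a b)"
    using D by (rule formal_deformation_lambda6_equivalent)
  \<comment> \<open>The second parameter of \<open>lambda6_ts\<close> is -t, so t has to be sent to
    \<open>- b\<close>.\<close>
  moreover have "aug (- b) = 0"
    using ab(2) by (simp add: aug_minus)
  then obtain f where f: "base_hom smul_ts aug_ts smul aug f" "f var_s = a" "f var_t = - b"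
    using base_hom_ts_exists[OF complete_base_axioms ab(1)] by blast
  ultimately show ex: "\<exists>f. base_hom smul_ts aug_ts smul aug f \<and>
      equivalent_deformations aug D (push_out f lambda6_ts)"
    using push_out by (intro exI[of _ f]) simp
  assume sq: "ideal_power {x. aug x = 0} 2 = {0}"
  have "f = g"
    if f: "base_hom smul_ts aug_ts smul aug f" "equivalent_deformations aug D (push_out f lambda6_ts)"
      and g: "base_hom smul_ts aug_ts smul aug g" "equivalent_deformations aug D (push_out g lambda6_ts)"
    for f g
  proof -
    have "f var_s = g var_s \<and> - f var_t = - g var_t"
      by (rule equivalent_lambda6_deformed_unique[OF deformation_axioms sq])
        (use f g aug_f push_out in simp_all)
    then show ?thesis
      using base_hom_ts_eqI[OF f(1) g(1) sq] by simp
  qed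
  with ex show "\<exists>!f. base_hom smul_ts aug_ts smul aug f \<and>
      equivalent_deformations aug D (push_out f lambda6_ts)"
    by blast
qed

theorem mainTheorem1:
  shows "formal_deformation smul_ts aug_ts lambda6 lambda6_ts \<and>
    versal TYPE('a::comm_ring_1) smul_ts aug_ts lambda6 lambda6_ts"
  using formal_deformation_lambda6_ts versal_lambda6_ts by blast

end
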